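(* Let $q$ be an odd prime power and $n$ an odd prime with $(q^n-1)/2$ even, let $Q=\frac{q^n-1}{q-1}$, and let $m$ be a divisor of $Q$. Then $$\mathcal{N}_0(m)\ \ge\ \theta(m)\,q^{\frac n2-1}\left\{q^{\frac n2}-2W(m)(q-1)\right\}.$$ Consequently, if $q^{\frac n2}>2W(Q)(q-1)$, then $\mathcal{N}_0(q^n-1)>0$.
   Context: For a divisor $m$ of $q^n-1$, $\xi\in\mathbb{F}_{q^n}^*$ is $m$-free if $\xi=\zeta^d$ with $d\mid m$, $\zeta\in\mathbb{F}_{q^n}^*$ implies $d=1$. $\mathcal{N}_0(m)$ is the number of $m$-free $\xi\in\mathbb{F}_{q^n}^*$ with $\mathrm{Tr}(\xi^2)=0$, where $\mathrm{Tr}:\mathbb{F}_{q^n}\to\mathbb{F}_q$ is the trace. $\theta(m)=\phi(m)/m$, and $W(m)=2^{\nu(m)}$ with $\nu(m)$ the number of distinct prime divisors of $m$. *)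

theory Defs
  imports Complex_Main "HOL-Number_Theory.Number_Theory"
begin

text \<open>The type \<open>'a\<close> plays the role of the field of \<open>q ^ n\<close> elements; its subfield of \<open>q\<close> elements
  is \<open>{x. x ^ q = x}\<close>.\<close>

text \<open>The trace to the subfield of \<open>q\<close> elements, as the sum of the conjugates \<open>x ^ (q ^ i)\<close>.
  Its values are elements of that subfield, seen inside \<open>'a\<close>.\<close>

definition Tr :: "nat \<Rightarrow> nat \<Rightarrow> 'a::finite_field \<Rightarrow> 'a" where
  "Tr q n x = (\<Sum>i<n. x ^ (q ^ i))"

definition m_free :: "nat \<Rightarrow> 'a::finite_field \<Rightarrow> bool" where
  "m_free m \<xi> \<longleftrightarrow> (\<forall>d \<zeta>. d dvd m \<longrightarrow> \<zeta> \<noteq> 0 \<longrightarrow> \<xi> = \<zeta> ^ d \<longrightarrow> d = 1)"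

definition N0 :: "'a::finite_field itself \<Rightarrow> nat \<Rightarrow> nat \<Rightarrow> nat \<Rightarrow> nat" where
  "N0 _ q n m = card {\<xi> :: 'a. \<xi> \<noteq> 0 \<and> m_free m \<xi> \<and> Tr q n (\<xi> ^ 2) = 0}"

definition theta :: "nat \<Rightarrow> real" where
  "theta m = real (totient m) / real m"

definition nu :: "nat \<Rightarrow> nat" where
  "nu m = card {p. prime p \<and> p dvd m}"

definition W :: "nat \<Rightarrow> nat" where
  "W m = 2 ^ nu m"

end

theory Submission
  imports "HOL-Algebra.Algebraic_Closure_Type" "HOL-Library.Real_Mod" "HOL-Library.Product_Plus" Defs
begin

text \<open>
  Both conditions on \<open>\<xi> ^ 2\<close> (trace zero and \<open>m\<close>-free) are invariant under the subfield, which
  consists of zero and the \<open>Q\<close>-th powers, and \<open>Q\<close> is odd; hence replacing \<open>\<xi> ^ 2\<close> by \<open>\<xi>\<close> does not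
  change the count. For a nontrivial character \<open>\<chi>\<close> that is trivial on the subfield, the sum of
  \<open>\<chi>\<close> over the nonzero elements of trace zero has absolute value exactly
  \<open>(q - 1) * q powr (n / 2 - 1)\<close>. The indicator of \<open>m\<close>-freeness is \<open>\<theta>(m)\<close> times a product over the
  primes \<open>p\<close> dividing \<open>m\<close> of one minus the mean of the nontrivial characters of order \<open>p\<close>; each
  factor at most doubles the error, which produces \<open>W(m)\<close>. Finally a \<open>Q\<close>-free element can be
  scaled by the subfield into a primitive one without affecting the trace condition.
\<close>

section \<open>Arithmetic preliminaries\<close>

lemma coprime_iff_no_common_prime:
  fixes a b :: nat
  shows "coprime a b \<longleftrightarrow> (\<forall>p. prime p \<longrightarrow> p dvd b \<longrightarrow> \<not> p dvd a)"
proof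
  show "\<forall>p. prime p \<longrightarrow> p dvd b \<longrightarrow> \<not> p dvd a" if "coprime a b"
    using that coprime_common_divisor_nat not_prime_1 by blast
  show "coprime a b" if none: "\<forall>p. prime p \<longrightarrow> p dvd b \<longrightarrow> \<not> p dvd a"
  proof (rule ccontr)
    assume "\<not> coprime a b"
    then have "gcd a b \<noteq> 1" using coprime_iff_gcd_eq_1 by blast
    then obtain p where "prime p" "p dvd gcd a b" using prime_factor_nat by blast
    then show False using none by auto
  qed
qed

text \<open>Take for \<open>j\<close> the product of the primes of \<open>b\<close> not dividing
  \<open>k\<close>. A prime of \<open>b\<close> divides exactly one of \<open>k\<close> and
  \<open>a * j\<close>, hence not their sum.\<close>

lemma exists_coprime_in_progression:
  fixes k a b :: nat
  assumes "coprime k a" "b > 0"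
  shows "\<exists>j. coprime (k + a * j) b"
proof -
  define S where "S = {p. prime p \<and> p dvd b \<and> \<not> p dvd k}"
  define j where "j = \<Prod>S"
  have fin: "finite S"
    using assms(2) by (intro finite_subset[OF _ finite_divisors_nat[of b]]) (auto simp: S_def)
  have "\<not> p dvd k + a * j" if p: "prime p" "p dvd b" for p
  proof (cases "p dvd k")
    case True
    have "\<not> p dvd j"
      using p True fin primes_dvd_imp_eq unfolding j_def
      by (auto simp: prime_dvd_prod_iff S_def)
    moreover have "\<not> p dvd a"
      using True p assms(1) by (metis coprime_common_divisor_nat not_prime_1)
    ultimately show ?thesis
      using True p by (simp add: dvd_add_right_iff prime_dvd_mult_iff)
  next
    case False
    then have "p dvd j" using p fin unfolding j_def S_def by (intro dvd_prodI) auto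
    then show ?thesis using False by (simp add: dvd_add_left_iff)
  qed
  then have "coprime (k + a * j) b"
    by (simp add: coprime_iff_no_common_prime)
  then show ?thesis ..
qed

lemma periodic_add_mult:
  fixes P :: "nat \<Rightarrow> bool"
  assumes "\<And>k. P (k + b) \<longleftrightarrow> P k"
  shows "P (k + c * b) \<longleftrightarrow> P k"
proof (induction c)
  case (Suc c)
  then show ?case using assms[of "k + c * b"] by (simp add: algebra_simps)
qed simp

lemma card_periodic:
  fixes P :: "nat \<Rightarrow> bool"
  assumes "\<And>k. P (k + b) \<longleftrightarrow> P k"
  shows "card {k. k < r * b \<and> P k} = r * card {k. k < b \<and> P k}"
proof (induction r)
  case (Suc r)
  note shift = periodic_add_mult[of P b, OF assms]
  have "{k. k < Suc r * b \<and> P k} =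
      {k. k < r * b \<and> P k} \<union> (\<lambda>k. k + r * b) ` {k. k < b \<and> P k}" (is "_ = ?A \<union> ?C")
  proof (intro equalityI subsetI)
    fix k assume k: "k \<in> {k. k < Suc r * b \<and> P k}"
    show "k \<in> ?A \<union> ?C"
    proof (cases "k < r * b")
      case False
      then obtain i where "k = i + r * b" by (metis add.commute le_Suc_ex not_less)
      then show ?thesis using k shift[of i r] by auto
    qed (use k in auto)
  qed (auto simp: shift)
  moreover have "card (?A \<union> ?C) = card ?A + card ?C"
    by (rule card_Un_disjoint) auto
  moreover have "card ?C = card {k. k < b \<and> P k}"
    by (rule card_image) (auto simp: inj_on_def)
  ultimately show ?case using Suc by simp
qed simp

text \<open>Doubling permutes the residues modulo the odd \<open>b\<close>, so both counts agree on
  one period, and \<open>r\<close> periods multiply each by \<open>r\<close>.\<close>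

lemma card_periodic_double:
  fixes P :: "nat \<Rightarrow> bool"
  assumes per: "\<And>k. P (k + b) \<longleftrightarrow> P k" and b: "odd b"
  shows "card {k. k < r * b \<and> P (2 * k)} = card {k. k < r * b \<and> P k}"
proof -
  note shift = periodic_add_mult[of P b, OF per]
  have Pmod: "P (k mod b) \<longleftrightarrow> P k" for k
    using shift[of "k mod b" "k div b"] by simp
  have b0: "b > 0" using b by (auto intro: Nat.gr0I)
  have inj: "inj_on (\<lambda>k. 2 * k mod b) {..<b}"
  proof (rule inj_onI)
    fix x y assume xy: "x \<in> {..<b}" "y \<in> {..<b}" "2 * x mod b = 2 * y mod b"
    then have "[2 * x = 2 * y] (mod b)" by (simp add: cong_def)
    then have "[x = y] (mod b)" using b by (simp add: cong_mult_lcancel_nat)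
    then show "x = y" using xy by (simp add: cong_def)
  qed
  have img: "(\<lambda>k. 2 * k mod b) ` {..<b} = {..<b}"
    using b0 inj by (intro endo_inj_surj) auto
  have "(\<lambda>k. 2 * k mod b) ` {k. k < b \<and> P (2 * k)} = {k. k < b \<and> P k}"
  proof (intro equalityI subsetI)
    fix k assume k: "k \<in> {k. k < b \<and> P k}"
    then have "k \<in> (\<lambda>k. 2 * k mod b) ` {..<b}" unfolding img by simp
    then obtain l where "l < b" "k = 2 * l mod b" by auto
    then show "k \<in> (\<lambda>k. 2 * k mod b) ` {k. k < b \<and> P (2 * k)}"
      using k Pmod[of "2 * l"] by auto
  qed (use b0 Pmod in auto)
  moreover have "inj_on (\<lambda>k. 2 * k mod b) {k. k < b \<and> P (2 * k)}"
    using inj by (rule inj_on_subset) auto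
  ultimately have "card {k. k < b \<and> P (2 * k)} = card {k. k < b \<and> P k}"
    by (metis card_image)
  moreover have "P (2 * (k + b)) \<longleftrightarrow> P (2 * k)" for k
    using shift[of "2 * k" 2] by (simp add: algebra_simps)
  ultimately show ?thesis
    using card_periodic[of P b r] card_periodic[of "\<lambda>k. P (2 * k)" b r] per by simp
qed

lemma theta_eq: "m > 0 \<Longrightarrow> theta m = (\<Prod>p\<in>prime_factors m. 1 - 1 / real p)"
  by (simp add: theta_def totient_formula2)

lemma cis_fraction_mod:
  assumes "p > 0"
  shows "cis (2 * pi * real k / real p) = cis (2 * pi * real (k mod p) / real p)"
proof -
  have "real k = real p * real (k div p) + real (k mod p)"
    by (metis mult_div_mod_eq of_nat_add of_nat_mult)
  then have "2 * pi * real k / real p =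
      2 * pi * real (k div p) + 2 * pi * real (k mod p) / real p"
    using assms by (simp add: field_simps)
  then show ?thesis by (simp add: cis_mult[symmetric])
qed

section \<open>Finite fields\<close>

lemma finite_field_generator:
  "\<exists>g::'a::finite_field. g \<noteq> 0 \<and> (\<forall>x. x \<noteq> 0 \<longrightarrow> (\<exists>k. x = g ^ k))"
proof -
  let ?R = "ring_of_type_algebra :: 'a ring"
  interpret R: field ?R by (rule field_from_type_algebra)
  have carrier: "carrier (mult_of ?R) = UNIV - {0}"
    by (auto simp: ring_of_type_algebra_def mult_of_simps)
  have pow: "a [^]\<^bsub>?R\<^esub> i = a ^ i" for a and i :: nat
    by (induction i) (auto simp: ring_of_type_algebra_def nat_pow_def mult.commute)
  obtain g where "g \<in> carrier (mult_of ?R)"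
    and "carrier (mult_of ?R) = {g [^]\<^bsub>?R\<^esub> i | i::nat. i \<in> UNIV}"
    using R.finite_field_mult_group_has_gen by auto
  then have "g \<noteq> 0" "UNIV - {0} = {g ^ i | i::nat. i \<in> UNIV}"
    unfolding carrier pow by auto
  then show ?thesis by blast
qed

text \<open>Every nonempty fibre injects into the kernel by a translation. Lower bounds for kernels
  obtained this way will meet upper bounds from polynomial degrees.\<close>

lemma card_le_range_times_kernel:
  fixes f :: "'a::{finite,ab_group_add} \<Rightarrow> 'b::ab_group_add"
  assumes add: "\<And>x y. f (x + y) = f x + f y" and "range f \<subseteq> B" "finite B"
  shows "card (UNIV :: 'a set) \<le> card B * card {x. f x = 0}"
proof -
  have fibre: "card {x. f x = b} \<le> card {x. f x = 0}" for b
  proof (cases "\<exists>a. f a = b")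
    case True
    then obtain a where a: "f a = b" by blast
    have diff: "f (x - a) = f x - f a" for x
      using add[of "x - a" a] by (simp add: algebra_simps)
    show ?thesis
      by (rule card_inj_on_le[of "\<lambda>x. x - a"]) (auto simp: inj_on_def diff a)
  qed auto
  have "card (UNIV :: 'a set) = card (\<Union>b\<in>B. {x. f x = b})"
    using assms(2) by (intro arg_cong[of _ _ card]) auto
  also have "\<dots> \<le> (\<Sum>b\<in>B. card {x. f x = b})"
    by (rule card_UN_le) fact
  also have "\<dots> \<le> (\<Sum>b\<in>B. card {x. f x = 0})"
    by (intro sum_mono fibre)
  finally show ?thesis by simp
qed

text \<open>The roots are those of a polynomial of degree at most \<open>q ^ (k - 1)\<close>. It is
  nonzero because only \<open>i = 0\<close> contributes to the coefficient of degree 1.\<close>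

lemma card_roots_additive_poly_le:
  fixes a :: "nat \<Rightarrow> 'a::field"
  assumes "q > 1" "k > 0" "a 0 \<noteq> 0"
  shows "card {x. (\<Sum>i<k. a i * x ^ (q ^ i)) = 0} \<le> q ^ (k - 1)"
proof -
  define p where "p = (\<Sum>i<k. monom (a i) (q ^ i))"
  have "coeff p 1 = (\<Sum>i<k. if i = 0 then a i else 0)"
    unfolding p_def coeff_sum using assms by (intro sum.cong) (auto simp: power_eq_1_iff)
  also have "\<dots> = a 0" using assms by simp
  finally have "p \<noteq> 0" using assms by auto
  have "degree p \<le> q ^ (k - 1)"
    unfolding p_def
  proof (intro degree_sum_le)
    fix i assume "i \<in> {..<k}"
    then have "q ^ i \<le> q ^ (k - 1)"
      using assms by (intro power_increasing) auto
    then show "degree (monom (a i) (q ^ i)) \<le> q ^ (k - 1)"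
      using degree_monom_le order_trans by blast
  qed auto
  moreover have "poly p x = (\<Sum>i<k. a i * x ^ (q ^ i))" for x
    by (simp add: p_def poly_sum poly_monom)
  ultimately show ?thesis
    using card_poly_roots_bound[OF \<open>p \<noteq> 0\<close>] by simp
qed

section \<open>The trace over a subfield\<close>

text \<open>Fixing a generator turns nonzero field elements into exponents modulo
  \<open>N\<close>.\<close>

locale field_extension =
  fixes q n :: nat and g :: "'a::finite_field"
  assumes q: "primepow q" and n: "n \<ge> 2"
    and card_UNIV: "card (UNIV :: 'a set) = q ^ n"
    and g_nonzero: "g \<noteq> 0"
    and g_generates: "x \<noteq> 0 \<Longrightarrow> \<exists>k. x = g ^ k"
begin

definition N where "N = q ^ n - 1"
definition Q where "Q = (q ^ n - 1) div (q - 1)"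
definition F where "F = {x::'a. x ^ q = x}"
definition H where "H = {x::'a. x \<noteq> 0 \<and> Tr q n x = 0}"

lemma q_gt_1: "q > 1"
  using q by (simp add: primepow_gt_Suc_0)

lemma N_pos: "N > 0"
  using q_gt_1 n one_less_power[of q n] unfolding N_def by simp

lemma N_eq: "N = (q - 1) * Q"
proof -
  have "int q - 1 dvd int q ^ n - 1"
    by (metis dvd_triv_left power_diff_1_eq)
  then have "int (q - 1) dvd int (q ^ n - 1)"
    using q_gt_1 by (simp add: of_nat_diff)
  then show ?thesis
    unfolding N_def Q_def by simp
qed

lemma Q_dvd_N: "Q dvd N" by (simp add: N_eq)

lemma Q_pos: "Q > 0" using N_pos N_eq by (cases "Q = 0") auto

lemma pow_q_n: "x ^ (q ^ n) = (x::'a)"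
  using finite_field_power_card_eq_same[of x] card_UNIV by simp

lemma pow_N: "x \<noteq> 0 \<Longrightarrow> x ^ N = (1::'a)"
proof -
  assume "x \<noteq> 0"
  moreover have "x * x ^ N = x"
    using pow_q_n[of x] q_gt_1 unfolding N_def by (metis Suc_diff_1 bot_nat_0.not_eq_extremum
      less_nat_zero_code not_one_less_zero power_Suc power_not_zero)
  ultimately show ?thesis by simp
qed

text \<open>The powers with exponent below \<open>N\<close> already exhaust the \<open>N\<close>
  nonzero elements, so by counting they are distinct.\<close>

lemma g_pow_eq_iff: "g ^ i = g ^ j \<longleftrightarrow> [i = j] (mod N)"
proof -
  have red: "g ^ i = g ^ (i mod N)" for i
  proof -
    have "g ^ i = g ^ (N * (i div N) + i mod N)" by simp
    also have "\<dots> = g ^ (i mod N)"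
      unfolding power_add power_mult by (simp add: pow_N g_nonzero)
    finally show ?thesis .
  qed
  have "UNIV - {0} = (\<lambda>k. g ^ k) ` {..<N}"
  proof (intro equalityI subsetI)
    fix x :: 'a assume "x \<in> UNIV - {0}"
    then obtain k where "x = g ^ k" using g_generates by auto
    then have "x = g ^ (k mod N)" using red by simp
    then show "x \<in> (\<lambda>k. g ^ k) ` {..<N}" using N_pos by auto
  qed (auto simp: g_nonzero)
  moreover have "card (UNIV - {0::'a}) = N" by (simp add: card_UNIV N_def card_Diff_subset)
  ultimately have "inj_on (\<lambda>k. g ^ k) {..<N}"
    by (intro eq_card_imp_inj_on) auto
  then have "g ^ (i mod N) = g ^ (j mod N) \<longleftrightarrow> i mod N = j mod N"
    using N_pos by (auto simp: inj_on_def)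
  then show ?thesis using red unfolding cong_def by metis
qed

lemma frobenius_add: "(x + y) ^ (q ^ i) = x ^ (q ^ i) + (y::'a) ^ (q ^ i)"
proof -
  obtain p k where pk: "prime p" "q = p ^ k" using q by (auto simp: primepow_def)
  have "CHAR('a) dvd p ^ (k * n)"
    using CHAR_dvd_CARD[where ?'a='a] card_UNIV pk by (simp add: power_mult)
  then have "CHAR('a) dvd p"
    using CHAR_prime prime_dvd_power by blast
  then have "CHAR('a) = p"
    using pk by (simp add: primes_dvd_imp_eq)
  then show ?thesis
    using pk by (intro freshmans_dream'[of _ "k * i"]) (auto simp: power_mult)
qed

lemma F_pow: "c \<in> F \<Longrightarrow> c ^ (q ^ i) = c"
  by (induction i) (auto simp: F_def power_mult)

lemma Tr_add: "Tr q n (x + y :: 'a) = Tr q n x + Tr q n y"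
  by (simp add: Tr_def frobenius_add sum.distrib)

lemma Tr_mult_F: "c \<in> F \<Longrightarrow> Tr q n (c * x) = c * Tr q n x"
  by (simp add: Tr_def power_mult_distrib F_pow sum_distrib_left)

lemma Tr_zero [simp]: "Tr q n 0 = (0::'a)"
  using q_gt_1 by (auto simp: Tr_def power_0_left)

text \<open>Raising to the power \<open>q\<close> moves each conjugate to the next one, and
  \<open>x ^ (q ^ n) = x\<close> closes the cycle.\<close>

lemma Tr_in_F: "Tr q n x \<in> F"
proof -
  have sum_pow: "(sum f A) ^ q = (\<Sum>i\<in>A. f i ^ q)" for f :: "nat \<Rightarrow> 'a" and A
    using frobenius_add[of _ _ 1] q_gt_1 by (induction A rule: infinite_finite_induct) auto
  have "Tr q n x ^ q = (\<Sum>i<n. x ^ (q ^ Suc i))"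
    unfolding Tr_def sum_pow by (simp add: mult.commute flip: power_mult)
  also have "\<dots> + x = (\<Sum>i<Suc n. x ^ (q ^ i))"
    by (subst sum.lessThan_Suc_shift) (simp add: add.commute)
  also have "\<dots> = Tr q n x + x"
    by (simp add: Tr_def pow_q_n)
  finally show ?thesis by (simp add: F_def)
qed

lemma card_F_le: "card F \<le> q"
proof -
  \<comment> \<open>\<open>F\<close> is the root set of the additive polynomial X^q - X, written
    with coefficients -1 and 1.\<close>
  have "card {x::'a. (\<Sum>i<2. (if i = 0 then -1 else 1) * x ^ (q ^ i)) = 0} \<le> q ^ (2 - 1)"
    using q_gt_1 by (intro card_roots_additive_poly_le) auto
  moreover have "(\<Sum>i<2. (if i = 0 then -1 else 1) * x ^ (q ^ i)) = x ^ q - x" for x :: 'a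
    by (simp add: numeral_2_eq_2)
  ultimately show ?thesis by (simp add: F_def)
qed

lemma card_ker_Tr_le: "card {x::'a. Tr q n x = 0} \<le> q ^ (n - 1)"
  using card_roots_additive_poly_le[of q n "\<lambda>_. 1::'a"] q_gt_1 n by (simp add: Tr_def)

text \<open>The trace maps into \<open>F\<close>, so q^n is at most the product of the two
  cardinalities; the degree bounds \<open>q\<close> and \<open>q ^ (n - 1)\<close> then both have to
  be attained.\<close>

lemma card_ker_Tr: "card {x::'a. Tr q n x = 0} = q ^ (n - 1)"
  and card_F: "card F = q"
proof -
  let ?K = "card {x::'a. Tr q n x = 0}"
  have "q * q ^ (n - 1) \<le> card F * ?K"
    using card_le_range_times_kernel[of "Tr q n :: 'a \<Rightarrow> 'a" F] Tr_add Tr_in_F card_UNIV n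
    by (auto simp flip: power_Suc)
  moreover have "card F * ?K \<le> q * ?K" "card F * ?K \<le> card F * q ^ (n - 1)"
    using card_F_le card_ker_Tr_le by simp_all
  ultimately have "q * q ^ (n - 1) \<le> q * ?K" "q * q ^ (n - 1) \<le> card F * q ^ (n - 1)"
    by linarith+
  then show "?K = q ^ (n - 1)" "card F = q"
    using card_F_le card_ker_Tr_le q_gt_1 by auto
qed

lemma card_H: "card H = q ^ (n - 1) - 1"
proof -
  have "H = {x. Tr q n x = 0} - {0}" by (auto simp: H_def)
  then show ?thesis by (simp add: card_ker_Tr)
qed

text \<open>On the common kernel, \<open>t ^ q ^ (n - 1) * Tr y - Tr (t * y)\<close> vanishes; its leading terms
  cancel, and its linear coefficient is nonzero because \<open>t\<close> is not fixed by Frobenius.\<close>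

lemma card_ker_Tr_pair:
  assumes "t \<notin> F"
  shows "card {y::'a. Tr q n y = 0 \<and> Tr q n (t * y) = 0} = q ^ (n - 2)"
proof -
  let ?K = "{y::'a. Tr q n y = 0 \<and> Tr q n (t * y) = 0}"
  define s where "s = t ^ (q ^ (n - 1))"
  have sq: "s ^ q = t"
    using n pow_q_n[of t] by (simp add: s_def flip: power_mult power_Suc2)
  have "s * Tr q n y - Tr q n (t * y) = (\<Sum>i<n-1. (s - t ^ (q ^ i)) * y ^ (q ^ i))" for y
  proof -
    have "s * Tr q n y - Tr q n (t * y) = (\<Sum>i<Suc (n-1). (s - t ^ (q ^ i)) * y ^ (q ^ i))"
      using n by (simp add: Tr_def sum_distrib_left power_mult_distrib algebra_simps
        flip: sum_subtractf)
    then show ?thesis by (simp add: s_def)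
  qed
  then have "?K \<subseteq> {y. (\<Sum>i<n-1. (s - t ^ (q ^ i)) * y ^ (q ^ i)) = 0}"
    by (smt (verit) Collect_mono diff_self mult_zero_right)
  then have "card ?K \<le> card {y. (\<Sum>i<n-1. (s - t ^ (q ^ i)) * y ^ (q ^ i)) = 0}"
    by (intro card_mono) auto
  also have "s \<noteq> t" using assms sq by (auto simp: F_def)
  then have "card {y. (\<Sum>i<n-1. (s - t ^ (q ^ i)) * y ^ (q ^ i)) = 0} \<le> q ^ (n - 1 - 1)"
    using n q_gt_1 by (intro card_roots_additive_poly_le) auto
  finally have le: "card ?K \<le> q ^ (n - 2)" by (simp add: numeral_2_eq_2)
  \<comment> \<open>The matching lower bound comes from the fibres of the additive map sending
    \<open>y\<close> to both traces.\<close>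
  have "card (UNIV :: 'a set) \<le> card (F \<times> F) * card {y. (Tr q n y, Tr q n (t * y)) = 0}"
    by (rule card_le_range_times_kernel) (auto simp: Tr_add Tr_in_F distrib_left)
  then have "q ^ n \<le> (q * q) * card ?K"
    by (simp add: card_UNIV card_cartesian_product card_F zero_prod_def)
  moreover have "q ^ n = (q * q) * q ^ (n - 2)"
    using n power_add[of q 2 "n - 2"] by (simp only: le_add_diff_inverse power2_eq_square)
  ultimately show ?thesis using le q_gt_1 by simp
qed

section \<open>Characters that are trivial on the subfield\<close>

text \<open>The value at 0 is left free, since only sums over nonzero elements occur.\<close>

definition character :: "('a \<Rightarrow> complex) \<Rightarrow> bool" where
  "character \<chi> \<longleftrightarrow> (\<forall>x y. x \<noteq> 0 \<longrightarrow> y \<noteq> 0 \<longrightarrow> \<chi> (x * y) = \<chi> x * \<chi> y) \<and>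
    (\<forall>x. x \<noteq> 0 \<longrightarrow> norm (\<chi> x) = 1) \<and> (\<forall>x\<in>F - {0}. \<chi> x = 1)"

lemma character_mult: "character \<chi> \<Longrightarrow> x \<noteq> 0 \<Longrightarrow> y \<noteq> 0 \<Longrightarrow> \<chi> (x * y) = \<chi> x * \<chi> y"
  and character_norm: "character \<chi> \<Longrightarrow> x \<noteq> 0 \<Longrightarrow> norm (\<chi> x) = 1"
  and character_F: "character \<chi> \<Longrightarrow> x \<in> F \<Longrightarrow> x \<noteq> 0 \<Longrightarrow> \<chi> x = 1"
  by (auto simp: character_def)

lemma character_one: "character (\<lambda>_. 1)"
  by (simp add: character_def)

lemma character_prod: "character \<chi> \<Longrightarrow> character \<psi> \<Longrightarrow> character (\<lambda>x. \<chi> x * \<psi> x)"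
  by (auto simp: character_def norm_mult)

lemma character_pow: "character \<chi> \<Longrightarrow> character (\<lambda>x. \<chi> x ^ j)"
  by (auto simp: character_def norm_power power_mult_distrib)

lemma sum_character_eq_0:
  assumes "character \<chi>" "a \<noteq> 0" "\<chi> a \<noteq> 1"
  shows "(\<Sum>x\<in>-{0}. \<chi> x) = 0"
proof -
  have "(\<Sum>x\<in>-{0}. \<chi> x) = (\<Sum>x\<in>-{0}. \<chi> (a * x))"
    by (rule sum.reindex_bij_witness[of _ "\<lambda>x. a * x" "\<lambda>x. x / a"]) (use assms in auto)
  also have "\<dots> = \<chi> a * (\<Sum>x\<in>-{0}. \<chi> x)"
    using assms by (auto simp: sum_distrib_left character_mult intro!: sum.cong)
  finally show ?thesis using assms by simp
qed

lemma card_H_inter_scaled: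
  assumes "t \<noteq> 0"
  shows "card {y\<in>H. t * y \<in> H} = (if t \<in> F then q ^ (n - 1) - 1 else q ^ (n - 2) - 1)"
proof (cases "t \<in> F")
  case True
  then have "{y\<in>H. t * y \<in> H} = H" using assms by (auto simp: H_def Tr_mult_F)
  then show ?thesis using True by (simp add: card_H)
next
  case False
  have "{y\<in>H. t * y \<in> H} = {y. Tr q n y = 0 \<and> Tr q n (t * y) = 0} - {0}"
    using assms by (auto simp: H_def)
  then show ?thesis using False by (simp add: card_ker_Tr_pair)
qed

text \<open>Squaring and substituting \<open>x = t * y\<close> reduces the sum to the counts of
  \<open>y\<close> with \<open>y\<close> and \<open>t * y\<close> both of trace zero, which take only two values.\<close>

lemma norm_sum_character_H:
  assumes "character \<chi>" "a \<noteq> 0" "\<chi> a \<noteq> 1"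
  shows "norm (\<Sum>x\<in>H. \<chi> x) = (real q - 1) * real q powr (real n / 2 - 1)"
proof -
  let ?S = "\<Sum>x\<in>H. \<chi> x"
  have nz: "y \<noteq> 0" if "y \<in> H" for y using that by (simp add: H_def)
  have "?S * cnj ?S = (\<Sum>y\<in>H. \<Sum>x\<in>H. \<chi> x * cnj (\<chi> y))"
    by (subst sum.swap) (simp add: sum_product)
  also have "\<dots> = (\<Sum>y\<in>H. \<Sum>t\<in>{t\<in>-{0}. t * y \<in> H}. \<chi> t)"
  proof (rule sum.cong[OF refl])
    fix y assume y: "y \<in> H"
    have unit: "\<chi> y * cnj (\<chi> y) = 1"
      using character_norm[OF assms(1) nz[OF y]] by (simp add: complex_norm_square[symmetric])
    show "(\<Sum>x\<in>H. \<chi> x * cnj (\<chi> y)) = (\<Sum>t\<in>{t\<in>-{0}. t * y \<in> H}. \<chi> t)"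
    proof (rule sum.reindex_bij_witness[of _ "\<lambda>t. t * y" "\<lambda>x. x / y"])
      fix x assume x: "x \<in> H"
      have "\<chi> x = \<chi> (x / y) * \<chi> y"
        using character_mult[OF assms(1), of "x / y" y] nz[OF x] nz[OF y] by simp
      then show "\<chi> (x / y) = \<chi> x * cnj (\<chi> y)" using unit by (simp add: mult.assoc)
    qed (use y nz in auto)
  qed
  also have "\<dots> = (\<Sum>t\<in>-{0}. \<Sum>y\<in>{y\<in>H. t * y \<in> H}. \<chi> t)"
    by (rule sum.swap_restrict) auto
  \<comment> \<open>The count is a constant plus an excess on \<open>F\<close>. Orthogonality will
    kill the constant part; on \<open>F\<close> the character is 1, so the excess carries no
    character.\<close>
  also have "\<dots> = (\<Sum>t\<in>-{0}. of_nat (q ^ (n - 2) - 1) * \<chi> t +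
      (if t \<in> F then of_nat (q ^ (n - 1)) - of_nat (q ^ (n - 2)) else 0))"
    using q_gt_1 by (intro sum.cong) (auto simp: card_H_inter_scaled of_nat_diff character_F[OF assms(1)])
  also have "\<dots> = of_nat (q ^ (n - 2) - 1) * (\<Sum>t\<in>-{0}. \<chi> t) +
      (\<Sum>t\<in>F-{0}. of_nat (q ^ (n - 1)) - of_nat (q ^ (n - 2)))"
    by (simp add: sum.distrib sum_distrib_left sum.If_cases Int_commute Diff_eq)
  also have "card (F - {0}) = q - 1"
    using card_F q_gt_1 by (subst card_Diff_subset) (auto simp: F_def)
  then have "of_nat (q ^ (n - 2) - 1) * (\<Sum>t\<in>-{0}. \<chi> t) +
      (\<Sum>t\<in>F-{0}. of_nat (q ^ (n - 1)) - of_nat (q ^ (n - 2)))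
      = complex_of_real ((real q - 1) * (real q ^ (n - 1) - real q ^ (n - 2)))"
    using sum_character_eq_0[OF assms] q_gt_1 by (simp add: of_nat_diff)
  finally have "complex_of_real ((norm ?S)\<^sup>2) = \<dots>"
    by (simp only: complex_norm_square)
  then have "(norm ?S)\<^sup>2 = (real q - 1) * (real q ^ (n - 1) - real q ^ (n - 2))"
    using of_real_eq_iff by blast
  also have "real q ^ (n - 1) = real q * real q ^ (n - 2)"
    using n by (simp add: numeral_2_eq_2 Suc_diff_Suc flip: power_Suc)
  also have "(real q - 1) * (real q * real q ^ (n - 2) - real q ^ (n - 2))
      = (real q - 1)\<^sup>2 * real q ^ (n - 2)"
    by (simp add: power2_eq_square algebra_simps)
  also have "real q ^ (n - 2) = (real q powr (real n / 2 - 1))\<^sup>2"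
    using q_gt_1 n by (simp add: powr_realpow[symmetric] of_nat_diff power2_eq_square
      powr_add[symmetric])
  finally have "(norm ?S)\<^sup>2 = ((real q - 1) * real q powr (real n / 2 - 1))\<^sup>2"
    by (simp add: power_mult_distrib)
  then show ?thesis
    using q_gt_1 by (simp add: power2_eq_iff_nonneg)
qed

section \<open>Counting, subfield membership and freeness in terms of exponents\<close>

lemma card_nonzero_eq_card_exponents:
  "card {x::'a. x \<noteq> 0 \<and> R x} = card {k. k < N \<and> R (g ^ k)}"
proof (rule bij_betw_same_card[symmetric, of "\<lambda>k. g ^ k"], unfold bij_betw_def, intro conjI)
  show "inj_on (\<lambda>k. g ^ k) {k. k < N \<and> R (g ^ k)}"
    by (auto simp: inj_on_def g_pow_eq_iff cong_def)
  show "(\<lambda>k. g ^ k) ` {k. k < N \<and> R (g ^ k)} = {x. x \<noteq> 0 \<and> R x}"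
  proof (intro equalityI subsetI)
    fix x assume x: "x \<in> {x. x \<noteq> 0 \<and> R x}"
    then obtain k where "x = g ^ k" using g_generates by auto
    then have "x = g ^ (k mod N)" by (simp add: g_pow_eq_iff)
    then show "x \<in> (\<lambda>k. g ^ k) ` {k. k < N \<and> R (g ^ k)}"
      using x N_pos by (intro image_eqI[of _ _ "k mod N"]) auto
  qed (auto simp: g_nonzero)
qed

text \<open>Being fixed by Frobenius means that \<open>N = (q - 1) * Q\<close> divides
  \<open>k * (q - 1)\<close>.\<close>

lemma g_pow_in_F_iff: "g ^ k \<in> F \<longleftrightarrow> Q dvd k"
proof -
  have "g ^ k \<in> F \<longleftrightarrow> [k * q = k] (mod N)"
    by (simp add: F_def g_pow_eq_iff flip: power_mult)
  also have "k * q = k * (q - 1) + k"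
    using q_gt_1 by (simp add: algebra_simps)
  also have "[k * (q - 1) + k = k] (mod N) \<longleftrightarrow> N dvd k * (q - 1)"
    using cong_add_rcancel_0_nat cong_0_iff by blast
  also have "\<dots> \<longleftrightarrow> Q dvd k"
    using q_gt_1 by (simp add: N_eq mult.commute)
  finally show ?thesis .
qed

text \<open>If \<open>d = gcd k m\<close>, then \<open>g ^ k\<close> is visibly a
  \<open>d\<close>-th power. Conversely, an equation with a \<open>d\<close>-th power is a
  congruence modulo \<open>N\<close>, which descends to the divisor \<open>d\<close>.\<close>

lemma m_free_g_pow_iff:
  assumes "m dvd N"
  shows "m_free m (g ^ k) \<longleftrightarrow> coprime k m"
proof
  assume free: "m_free m (g ^ k)"
  define d where "d = gcd k m"
  have "g ^ k = (g ^ (k div d)) ^ d" by (simp add: d_def flip: power_mult)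
  then have "d = 1"
    using free g_nonzero unfolding m_free_def d_def by (metis gcd_dvd2 power_not_zero)
  then show "coprime k m" unfolding d_def coprime_iff_gcd_eq_1 .
next
  assume cop: "coprime k m"
  show "m_free m (g ^ k)"
    unfolding m_free_def
  proof (intro allI impI)
    fix d \<zeta> assume d: "d dvd m" and "\<zeta> \<noteq> 0" and eq: "g ^ k = \<zeta> ^ d"
    then obtain l where "\<zeta> = g ^ l" using g_generates by auto
    then have "[k = l * d] (mod N)"
      using eq by (simp add: g_pow_eq_iff flip: power_mult)
    then have "[k = l * d] (mod d)"
      using d assms cong_dvd_modulus_nat dvd_trans by blast
    then have "d dvd k" by (simp add: cong_dvd_iff)
    then show "d = 1" using cop d coprime_common_divisor_nat by blast
  qed
qed

section \<open>Characters of prime order\<close>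

text \<open>The character sending \<open>g\<close> to exp(2 pi i / p). The chosen logarithm does not
  affect the value once \<open>p\<close> divides \<open>N\<close>.\<close>

definition chi :: "nat \<Rightarrow> 'a \<Rightarrow> complex" where
  "chi p x = cis (2 * pi * real (SOME k. x = g ^ k) / real p)"

lemma chi_g_pow:
  assumes "p dvd N"
  shows "chi p (g ^ k) = cis (2 * pi * real k / real p)"
proof -
  define l where "l = (SOME l. g ^ k = g ^ l)"
  have "g ^ k = g ^ l" unfolding l_def by (rule someI) simp
  then have "[k = l] (mod p)"
    using assms cong_dvd_modulus_nat g_pow_eq_iff by blast
  moreover have p: "p > 0" using assms N_pos by (auto intro: Nat.gr0I)
  ultimately show ?thesis
    using cis_fraction_mod[OF p, of k] cis_fraction_mod[OF p, of l]
    unfolding chi_def l_def[symmetric] cong_def by simp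
qed

lemma chi_g_pow_eq_1_iff:
  assumes "p dvd N"
  shows "chi p (g ^ k) = 1 \<longleftrightarrow> p dvd k"
proof -
  have p: "p > 0" using assms N_pos by (auto intro: Nat.gr0I)
  have "chi p (g ^ k) = 1 \<longleftrightarrow> (\<exists>i. 2 * pi * real k / real p = of_int i * (2 * pi))"
    by (simp add: chi_g_pow assms cis_eq_1_iff)
  also have "\<dots> \<longleftrightarrow> (\<exists>i. real_of_int (int k) = real_of_int (int p * i))"
    using p by (simp add: field_simps)
  also have "\<dots> \<longleftrightarrow> int p dvd int k"
    unfolding of_int_eq_iff dvd_def ..
  finally show ?thesis by simp
qed

lemma chi_pow_g_pow:
  assumes "p dvd N"
  shows "chi p (g ^ k) ^ j = chi p (g ^ (k * j))"
  by (simp add: chi_g_pow assms DeMoivre mult_ac)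

lemma chi_pow_self:
  assumes "p dvd N" "x \<noteq> 0"
  shows "chi p x ^ p = 1"
  using assms g_generates[OF assms(2)] by (auto simp: chi_pow_g_pow chi_g_pow_eq_1_iff)

text \<open>Exponents of subfield elements are multiples of \<open>Q\<close>, hence of
  \<open>p\<close>. This is where divisors of \<open>Q\<close>, rather than of \<open>N\<close>,
  enter.\<close>

lemma character_chi:
  assumes "p dvd Q"
  shows "character (chi p)"
proof -
  have pN: "p dvd N" using assms Q_dvd_N dvd_trans by blast
  have "chi p (g ^ i * g ^ j) = chi p (g ^ i) * chi p (g ^ j)" for i j
    by (simp add: chi_g_pow pN cis_mult add_divide_distrib distrib_left flip: power_add)
  moreover have "norm (chi p x) = 1" for x by (simp add: chi_def)
  moreover have "chi p (g ^ k) = 1" if "g ^ k \<in> F" for k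
    using that assms dvd_trans by (simp add: chi_g_pow_eq_1_iff pN g_pow_in_F_iff) blast
  ultimately show ?thesis
    unfolding character_def using g_generates by (metis DiffD1 DiffD2 singletonI)
qed

section \<open>Sieving for free elements\<close>

text \<open>The local factor at \<open>p\<close> in the character expansion of the freeness
  indicator, with 1 - 1/p taken out.\<close>

definition h :: "nat \<Rightarrow> 'a \<Rightarrow> complex" where
  "h p x = 1 - (\<Sum>j\<in>{1..<p}. chi p x ^ j) / of_nat (p - 1)"

text \<open>The nontrivial powers of \<open>chi p x\<close> sum to p - 1 if this value is 1, and to
  -1 otherwise; so \<open>h p x\<close> is 0 or p/(p - 1).\<close>

lemma h_eq:
  assumes "prime p" "p dvd N" "x \<noteq> 0"
  shows "of_real (1 - 1 / real p) * h p x = (if chi p x = 1 then 0 else 1)"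
proof -
  have p: "p > 1" using assms prime_gt_1_nat by blast
  show ?thesis
  proof (cases "chi p x = 1")
    case True
    then show ?thesis using p by (simp add: h_def)
  next
    case False
    have "(\<Sum>j\<in>{..<p}. chi p x ^ j) = 0"
      using geometric_sum[OF False, of p] chi_pow_self[OF assms(2,3)] by simp
    moreover have "{..<p} = insert 0 {1..<p}" using p by auto
    ultimately have "(\<Sum>j\<in>{1..<p}. chi p x ^ j) = -1"
      by (simp add: add_eq_0_iff)
    then show ?thesis
      using False p by (simp add: h_def of_nat_diff field_simps)
  qed
qed

text \<open>The twist by an arbitrary \<open>\<chi>\<close> lets an induction on \<open>P\<close>
  absorb powers of \<open>chi p\<close> into the character.\<close>

definition T :: "nat set \<Rightarrow> ('a \<Rightarrow> complex) \<Rightarrow> complex" where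
  "T P \<chi> = (\<Sum>x\<in>H. \<chi> x * (\<Prod>p\<in>P. h p x))"

lemma T_insert:
  assumes "finite P" "p \<notin> P"
  shows "T (insert p P) \<chi> =
    T P \<chi> - (\<Sum>j\<in>{1..<p}. T P (\<lambda>x. \<chi> x * chi p x ^ j)) / of_nat (p - 1)"
proof -
  define c :: complex where "c = of_nat (p - 1)"
  have "(\<Sum>j\<in>{1..<p}. T P (\<lambda>x. \<chi> x * chi p x ^ j)) =
      (\<Sum>x\<in>H. \<Sum>j\<in>{1..<p}. \<chi> x * chi p x ^ j * (\<Prod>p\<in>P. h p x))"
    unfolding T_def by (rule sum.swap)
  also have "\<dots> = (\<Sum>x\<in>H. \<chi> x * (\<Prod>p\<in>P. h p x) * (\<Sum>j\<in>{1..<p}. chi p x ^ j))"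
    by (simp add: sum_distrib_left mult_ac)
  finally have swap: "(\<Sum>j\<in>{1..<p}. T P (\<lambda>x. \<chi> x * chi p x ^ j)) = \<dots>" .
  have "T (insert p P) \<chi> = (\<Sum>x\<in>H. \<chi> x * (\<Prod>p\<in>P. h p x) -
      \<chi> x * (\<Prod>p\<in>P. h p x) * (\<Sum>j\<in>{1..<p}. chi p x ^ j) / c)"
    unfolding T_def using assms
    by (intro sum.cong refl)
      (simp add: h_def[of p] c_def right_diff_distrib left_diff_distrib mult_ac del: of_nat_diff)
  then show ?thesis
    unfolding swap c_def[symmetric] by (simp only: sum_subtractf sum_divide_distrib T_def)
qed

text \<open>Adding \<open>p\<close> subtracts a mean of twisted sums over \<open>P\<close>. Each
  twist is nontrivial, so it has main term of norm \<open>B\<close> and inductive error at most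
  (2^|P| - 1)B, together at most 2^|P| B; the error thus grows to (2^(|P|+1) - 1)B. The exponent
  \<open>M\<close>, which kills \<open>\<chi>\<close> and is coprime to the primes in
  \<open>P\<close>, is what keeps the twists nontrivial.\<close>

lemma norm_T_diff_le:
  assumes "finite P" "\<forall>p\<in>P. prime p \<and> p dvd Q" "character \<chi>"
    and "\<forall>x. x \<noteq> 0 \<longrightarrow> \<chi> x ^ M = 1" "\<forall>p\<in>P. coprime p M"
  defines "B \<equiv> (real q - 1) * real q powr (real n / 2 - 1)"
  shows "norm (T P \<chi> - T {} \<chi>) \<le> (2 ^ card P - 1) * B"
  using assms(1-5)
proof (induction P arbitrary: \<chi> M rule: finite_induct)
  case (insert p P)
  have p: "prime p" "p dvd Q" "coprime p M" using insert.prems by auto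
  have pN: "p dvd N" using p Q_dvd_N dvd_trans by blast
  have p1: "p > 1" using p prime_gt_1_nat by blast
  have bound: "norm (T P (\<lambda>x. \<chi> x * chi p x ^ j)) \<le> 2 ^ card P * B"
    if j: "j \<in> {1..<p}" for j
  proof -
    let ?\<psi> = "\<lambda>x. \<chi> x * chi p x ^ j"
    have char: "character ?\<psi>"
      using insert.prems p by (intro character_prod character_pow character_chi) auto
    have ord: "?\<psi> x ^ (M * p) = 1" if "x \<noteq> 0" for x
    proof -
      have "?\<psi> x ^ (M * p) = (\<chi> x ^ M) ^ p * (chi p x ^ p) ^ (j * M)"
        by (simp add: power_mult_distrib mult_ac flip: power_mult)
      then show ?thesis using that insert.prems chi_pow_self[OF pN that] by simp
    qed
    have "\<forall>r\<in>P. coprime r (M * p)"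
      using insert p by (metis coprime_mult_right_iff insertCI primes_coprime)
    then have IH: "norm (T P ?\<psi> - T {} ?\<psi>) \<le> (2 ^ card P - 1) * B"
      using insert.prems char ord by (intro insert.IH[where M = "M * p"]) auto
    \<comment> \<open>The power \<open>M\<close> removes \<open>\<chi>\<close>, so a value 1 would
      force \<open>p\<close> to divide \<open>j * M\<close>, hence \<open>j\<close>, although 0 < j
      < p.\<close>
    have "?\<psi> g \<noteq> 1"
    proof
      assume "?\<psi> g = 1"
      then have "(?\<psi> g) ^ M = 1" by simp
      then have "chi p (g ^ 1) ^ (j * M) = 1"
        using insert.prems g_nonzero by (simp add: power_mult_distrib power_mult)
      then have "p dvd j * M"
        unfolding chi_pow_g_pow[OF pN] chi_g_pow_eq_1_iff[OF pN] by simp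
      then have "p dvd j" using p by (simp add: coprime_dvd_mult_left_iff)
      then show False using j by (auto dest: dvd_imp_le)
    qed
    then have "norm (T {} ?\<psi>) = B"
      using norm_sum_character_H[OF char g_nonzero] by (simp add: T_def B_def)
    then have "norm (T P ?\<psi>) \<le> (2 ^ card P - 1) * B + B"
      using IH norm_triangle_sub[of "T P ?\<psi>" "T {} ?\<psi>"] by linarith
    then show ?thesis by (simp add: algebra_simps)
  qed
  let ?S = "\<Sum>j\<in>{1..<p}. T P (\<lambda>x. \<chi> x * chi p x ^ j)"
  have "norm ?S \<le> real (p - 1) * (2 ^ card P * B)"
    using sum_norm_bound[of "{1..<p}" "\<lambda>j. T P (\<lambda>x. \<chi> x * chi p x ^ j)", OF bound] by simp
  then have "norm (?S / of_nat (p - 1)) \<le> 2 ^ card P * B"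
    using p1 by (simp add: norm_divide field_simps del: of_nat_diff)
  moreover have "norm (T P \<chi> - T {} \<chi>) \<le> (2 ^ card P - 1) * B"
    using insert.prems by (intro insert.IH[where M = M]) auto
  moreover have "T (insert p P) \<chi> - T {} \<chi> = (T P \<chi> - T {} \<chi>) - ?S / of_nat (p - 1)"
    using insert.hyps by (simp add: T_insert)
  then have "norm (T (insert p P) \<chi> - T {} \<chi>)
      \<le> norm (T P \<chi> - T {} \<chi>) + norm (?S / of_nat (p - 1))"
    by (simp only: norm_triangle_ineq4)
  ultimately have "norm (T (insert p P) \<chi> - T {} \<chi>) \<le> (2 ^ card P - 1) * B + 2 ^ card P * B"
    by linarith
  then show ?case using insert.hyps by (simp add: algebra_simps)
qed simp

lemma m_free_iff_chi:
  assumes "m dvd N" "x \<noteq> 0"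
  shows "m_free m x \<longleftrightarrow> (\<forall>p\<in>prime_factors m. chi p x \<noteq> 1)"
proof -
  obtain k where k: "x = g ^ k" using g_generates assms by blast
  have m: "m \<noteq> 0" using assms N_pos by auto
  have "coprime k m \<longleftrightarrow> (\<forall>p\<in>prime_factors m. \<not> p dvd k)"
    using m by (auto simp: prime_factors_dvd coprime_iff_no_common_prime)
  also have "\<dots> \<longleftrightarrow> (\<forall>p\<in>prime_factors m. chi p x \<noteq> 1)"
    using assms dvd_trans unfolding k
    by (intro ball_cong refl) (subst chi_g_pow_eq_1_iff, auto simp: prime_factors_dvd)
  finally show ?thesis using k assms by (simp add: m_free_g_pow_iff)
qed

text \<open>Distributing the Euler product of \<open>theta m\<close> over the factors
  \<open>h p x\<close> turns each into the indicator of \<open>chi p x \<noteq> 1\<close>; their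
  product is the indicator of freeness.\<close>

lemma card_m_free_H:
  assumes "m dvd N"
  shows "of_nat (card {x\<in>H. m_free m x}) = of_real (theta m) * T (prime_factors m) (\<lambda>_. 1)"
proof -
  have m: "m > 0" using assms N_pos by (auto intro: Nat.gr0I)
  have "of_real (theta m) * T (prime_factors m) (\<lambda>_. 1)
      = (\<Sum>x\<in>H. \<Prod>p\<in>prime_factors m. of_real (1 - 1 / real p) * h p x)"
    by (simp add: theta_eq m T_def sum_distrib_left prod.distrib)
  also have "\<dots> = (\<Sum>x\<in>H. if m_free m x then 1 else 0)"
  proof (rule sum.cong[OF refl])
    fix x assume "x \<in> H"
    then have x: "x \<noteq> 0" by (simp add: H_def)
    have "(\<Prod>p\<in>prime_factors m. of_real (1 - 1 / real p) * h p x)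
        = (\<Prod>p\<in>prime_factors m. if chi p x = 1 then 0 else 1)"
      using assms x dvd_trans by (intro prod.cong h_eq refl) (auto simp: prime_factors_dvd)
    also have "\<dots> = (if m_free m x then 1 else 0)"
      using m_free_iff_chi[OF assms x] by (auto intro!: prod.neutral prod_zero)
    finally show "(\<Prod>p\<in>prime_factors m. of_real (1 - 1 / real p) * h p x) = \<dots>" .
  qed
  also have "\<dots> = of_nat (card {x\<in>H. m_free m x})"
    by (simp add: sum.If_cases Int_def)
  finally show ?thesis by simp
qed

text \<open>The main term \<open>T {} (\<lambda>_. 1)\<close> is the cardinality of
  \<open>H\<close>; the sieve error is bounded starting from the trivial character, with
  \<open>M = 1\<close>.\<close>

lemma card_m_free_H_ge:
  assumes "m dvd Q"
  shows "real (card {x\<in>H. m_free m x}) \<ge> theta m *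
    (real q ^ (n - 1) - 1 - (real (W m) - 1) * ((real q - 1) * real q powr (real n / 2 - 1)))"
proof -
  let ?P = "prime_factors m"
  let ?B = "(real q - 1) * real q powr (real n / 2 - 1)"
  have mN: "m dvd N" using assms Q_dvd_N dvd_trans by blast
  have m: "m > 0" using mN N_pos by (auto intro: Nat.gr0I)
  have "norm (T ?P (\<lambda>_. 1) - T {} (\<lambda>_. 1)) \<le> (2 ^ card ?P - 1) * ?B"
    using assms dvd_trans
    by (intro norm_T_diff_le[where M = 1]) (auto simp: character_one prime_factors_dvd)
  moreover have "?P = {p. prime p \<and> p dvd m}"
    using m by (auto simp: prime_factors_dvd)
  then have "2 ^ card ?P = real (W m)" by (simp add: W_def nu_def)
  moreover have "T {} (\<lambda>_. 1) = of_real (real q ^ (n - 1) - 1)"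
    using q_gt_1 by (simp add: T_def card_H of_nat_diff)
  moreover have "Re (T {} (\<lambda>_. 1) - T ?P (\<lambda>_. 1)) \<le> norm (T ?P (\<lambda>_. 1) - T {} (\<lambda>_. 1))"
    by (metis complex_Re_le_cmod norm_minus_commute)
  ultimately have "Re (T ?P (\<lambda>_. 1)) \<ge> real q ^ (n - 1) - 1 - (real (W m) - 1) * ?B"
    by simp
  moreover have "real (card {x\<in>H. m_free m x}) = theta m * Re (T ?P (\<lambda>_. 1))"
    using arg_cong[OF card_m_free_H[OF mN], of Re] by simp
  moreover have "theta m \<ge> 0" by (simp add: theta_def)
  ultimately show ?thesis by (simp add: mult_left_mono)
qed

section \<open>Removing the square\<close>

text \<open>\<open>g ^ (Q * j)\<close> lies in the subfield and factors out of the trace.\<close>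

lemma Tr_shift_eq_0_iff: "Tr q n (g ^ (k + Q * j)) = 0 \<longleftrightarrow> Tr q n (g ^ k) = 0"
proof -
  have "Tr q n (g ^ (k + Q * j)) = g ^ (Q * j) * Tr q n (g ^ k)"
    using Tr_mult_F[of "g ^ (Q * j)" "g ^ k"] g_pow_in_F_iff[of "Q * j"]
    by (simp add: power_add mult.commute)
  then show ?thesis using g_nonzero by simp
qed

text \<open>Both conditions on \<open>g ^ l\<close> depend only on \<open>l\<close> modulo the odd number \<open>Q\<close>, where doubling
  is a permutation.\<close>

lemma N0_eq_card_m_free_H:
  assumes "m dvd Q" "odd Q"
  shows "N0 TYPE('a) q n m = card {x\<in>H. m_free m x}"
proof -
  define P where "P l \<longleftrightarrow> coprime l m \<and> Tr q n (g ^ l) = 0" for l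
  have mN: "m dvd N" using assms Q_dvd_N dvd_trans by blast
  have per: "P (k + Q) \<longleftrightarrow> P k" for k
  proof -
    have "coprime (k + Q) m \<longleftrightarrow> coprime k m"
      unfolding coprime_iff_no_common_prime
      using assms(1) by (meson dvd_add_left_iff dvd_trans)
    then show ?thesis using Tr_shift_eq_0_iff[of k 1] by (simp add: P_def)
  qed
  \<comment> \<open>For odd \<open>m\<close>, coprimality of \<open>k\<close> and of
    \<open>2 * k\<close> to \<open>m\<close> agree, so the condition on \<open>\<xi>\<close> becomes
    \<open>P\<close> at the doubled exponent.\<close>
  have "odd m" using assms dvd_trans by blast
  then have "N0 TYPE('a) q n m = card {k. k < N \<and> P (2 * k)}"
    unfolding N0_def card_nonzero_eq_card_exponents
    by (simp add: P_def m_free_g_pow_iff[OF mN] mult.commute flip: power_mult)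
  also have "\<dots> = card {k. k < N \<and> P k}"
    unfolding N_eq by (rule card_periodic_double) (use per assms in auto)
  also have "\<dots> = card {x::'a. x \<noteq> 0 \<and> (Tr q n x = 0 \<and> m_free m x)}"
    using card_nonzero_eq_card_exponents[of "\<lambda>x. Tr q n x = 0 \<and> m_free m x"]
    by (simp add: P_def m_free_g_pow_iff[OF mN] conj_commute)
  also have "{x::'a. x \<noteq> 0 \<and> (Tr q n x = 0 \<and> m_free m x)} = {x\<in>H. m_free m x}"
    by (auto simp: H_def)
  finally show ?thesis .
qed

section \<open>From free to primitive elements\<close>

text \<open>Shifting the exponent of a \<open>Q\<close>-free element by a suitable multiple of
  \<open>Q\<close> makes it coprime to \<open>N\<close>; the square then changes only by a subfield
  factor.\<close>

lemma N0_primitive_pos: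
  assumes "N0 TYPE('a) q n Q > 0"
  shows "N0 TYPE('a) q n N > 0"
proof -
  obtain \<xi> :: 'a where \<xi>: "\<xi> \<noteq> 0" "m_free Q \<xi>" "Tr q n (\<xi> ^ 2) = 0"
    using assms unfolding N0_def by (auto simp: card_gt_0_iff)
  obtain k where k: "\<xi> = g ^ k" using g_generates \<xi> by blast
  then have "coprime k Q" using \<xi> m_free_g_pow_iff[OF Q_dvd_N] by simp
  then obtain j where j: "coprime (k + Q * j) N"
    using exists_coprime_in_progression N_pos by blast
  let ?\<eta> = "g ^ (k + Q * j)"
  have "?\<eta> ^ 2 = g ^ (2 * k + Q * (2 * j))"
    by (simp add: algebra_simps flip: power_mult)
  then have "Tr q n (?\<eta> ^ 2) = 0"
    using \<xi> k by (simp only: Tr_shift_eq_0_iff) (simp add: mult.commute flip: power_mult)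
  moreover have "m_free N ?\<eta>" using j by (simp add: m_free_g_pow_iff)
  ultimately have "?\<eta> \<in> {\<xi>. \<xi> \<noteq> 0 \<and> m_free N \<xi> \<and> Tr q n (\<xi> ^ 2) = 0}"
    using g_nonzero by simp
  then show ?thesis unfolding N0_def by (auto simp: card_gt_0_iff)
qed

section \<open>The explicit lower bound and the parity of \<open>Q\<close>\<close>

lemma N0_ge:
  assumes "m dvd Q" "odd Q"
  shows "real (N0 TYPE('a) q n m) \<ge> theta m * real q powr (real n / 2 - 1) *
    (real q powr (real n / 2) - 2 * real (W m) * (real q - 1))"
proof -
  let ?r = "real q powr (real n / 2 - 1)"
  let ?B = "(real q - 1) * ?r"
  have q: "real q \<ge> 2" using q_gt_1 by simp
  have "?r \<ge> 1" using q n by (intro ge_one_powr_ge_zero) auto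
  then have B: "?B \<ge> 1" using q mult_mono[of 1 "real q - 1" 1 ?r] by simp
  have W: "real (W m) \<ge> 1" by (simp add: W_def)
  have "real q ^ (n - 1) = ?r * real q powr (real n / 2)"
    using q n by (simp add: powr_realpow[symmetric] of_nat_diff powr_add[symmetric])
  \<comment> \<open>The sieve bound exceeds the simpler target, before the factor
    \<open>theta m\<close>, by exactly \<open>(real (W m) + 1) * ?B - 1\<close>.\<close>
  moreover have "1 \<le> (real (W m) + 1) * ?B"
    using mult_mono[of 1 "real (W m) + 1" 1 ?B] B W by simp
  ultimately have "?r * (real q powr (real n / 2) - 2 * real (W m) * (real q - 1))
      \<le> real q ^ (n - 1) - 1 - (real (W m) - 1) * ?B"
    by (simp add: algebra_simps)
  moreover have "theta m \<ge> 0" by (simp add: theta_def)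
  ultimately have "theta m * (?r * (real q powr (real n / 2) - 2 * real (W m) * (real q - 1)))
      \<le> theta m * (real q ^ (n - 1) - 1 - (real (W m) - 1) * ?B)"
    by (rule mult_left_mono)
  then show ?thesis
    using card_m_free_H_ge[OF assms(1)] by (simp add: N0_eq_card_m_free_H[OF assms] mult.assoc)
qed

text \<open>\<open>Q\<close> is the geometric sum 1 + q + ... + q^(n-1), an odd number of odd
  terms.\<close>

lemma odd_Q:
  assumes "odd q" "odd n"
  shows "odd Q"
proof -
  have "int N = (int q - 1) * (\<Sum>i<n. int q ^ i)"
    using q_gt_1 power_diff_1_eq[of "int q" n] by (simp add: N_def of_nat_diff)
  moreover have "int N = (int q - 1) * int Q"
    using q_gt_1 by (simp add: N_eq of_nat_diff)
  ultimately have "int Q = (\<Sum>i<n. int q ^ i)" using q_gt_1 by simp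
  moreover have "even (\<Sum>i<k. int q ^ i) \<longleftrightarrow> even k" for k
    using assms(1) by (induction k) auto
  ultimately show ?thesis using assms(2) by (metis even_of_nat)
qed

end

theorem theorem5p5:
  fixes q n Q :: nat
  assumes "primepow q" and "odd q"
    and "prime n" and "odd n"
    and "even ((q ^ n - 1) div 2)"
    and "card (UNIV :: 'a::finite_field set) = q ^ n"
    and "Q = (q ^ n - 1) div (q - 1)"
  shows "(\<forall>m. m dvd Q \<longrightarrow>
            real (N0 TYPE('a) q n m) \<ge>
              theta m * real q powr (real n / 2 - 1) *
                (real q powr (real n / 2) - 2 * real (W m) * (real q - 1))) \<and>
         (real q powr (real n / 2) > 2 * real (W Q) * (real q - 1) \<longrightarrow>
            N0 TYPE('a) q n (q ^ n - 1) > 0)"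
proof -
  obtain g :: 'a where "g \<noteq> 0" "\<forall>x. x \<noteq> 0 \<longrightarrow> (\<exists>k. x = g ^ k)"
    using finite_field_generator by blast
  then interpret E: field_extension q n g
    using assms prime_ge_2_nat by unfold_locales auto
  have Q: "Q = E.Q" using assms by (simp add: E.Q_def)
  have odd: "odd E.Q" using assms E.odd_Q by blast
  have ge: "real (N0 TYPE('a) q n m) \<ge> theta m * real q powr (real n / 2 - 1) *
      (real q powr (real n / 2) - 2 * real (W m) * (real q - 1))" if "m dvd Q" for m
    using that E.N0_ge odd Q by simp
  have "N0 TYPE('a) q n (q ^ n - 1) > 0"
    if "real q powr (real n / 2) > 2 * real (W Q) * (real q - 1)"
  proof -
    \<comment> \<open>Positivity of \<open>theta Q\<close> makes the bound at \<open>m = Q\<close>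
      strictly positive; the resulting \<open>Q\<close>-free element is then replaced by a primitive
      one.\<close>
    have "theta Q > 0" using E.Q_pos by (simp add: theta_def Q)
    then have "0 < theta Q * real q powr (real n / 2 - 1) *
        (real q powr (real n / 2) - 2 * real (W Q) * (real q - 1))"
      using that E.q_gt_1 by simp
    then have "N0 TYPE('a) q n Q > 0" using ge[of Q] by simp
    then show ?thesis using E.N0_primitive_pos by (simp add: Q E.N_def)
  qed
  then show ?thesis using ge by blast
qed

end
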